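(* Let $\mathbf{n}=(n_1,\ldots,n_d)\in\mathbb{N}^d$ have pairwise relatively prime entries and let $\boldsymbol{\kappa}\in\mathbb{Z}^d$. The functions $\chi^{(2\mathbf{n})}_{\boldsymbol{\gamma}}$, $\boldsymbol{\gamma}\in\Gamma^{(2\mathbf{n})}_{\boldsymbol{\kappa}}$, form an orthogonal basis of the inner product space $(\mathcal{L}(I^{(2\mathbf{n})}_{\boldsymbol{\kappa}}),\langle\cdot,\cdot\rangle_{\omega^{(2\mathbf{n})}_{\boldsymbol{\kappa}}})$. Further, the norms of the basis elements satisfy $$\|\chi^{(2\mathbf{n})}_{\boldsymbol{\gamma}}\|^2_{\omega^{(2\mathbf{n})}_{\boldsymbol{\kappa}}}=\begin{cases}2^{-\mathfrak{e}(\boldsymbol{\gamma})+\mathfrak{f}^{(2\mathbf{n})}(\boldsymbol{\gamma})},&\text{if }\boldsymbol{\gamma}\in\Gamma^{(2\mathbf{n})}_{\boldsymbol{\kappa}}\setminus\{(0,\ldots,0,2n_d)\},\\ 1,&\text{if }\boldsymbol{\gamma}=(0,\ldots,0,2n_d).\end{cases}$$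
   Context: $\mathbb{N}=\{1,2,\ldots\}$, $\mathbb{N}_0=\mathbb{N}\cup\{0\}$, $d\in\mathbb{N}$, $p[\mathbf{n}]=\prod_{j=1}^dn_j$. For $\mathfrak{r}\in\{0,1\}$ let $I^{(2\mathbf{n})}_{\boldsymbol{\kappa},\mathfrak{r}}$ be the set of all $\mathbf{i}\in\mathbb{N}_0^d$ with $0\le i_j\le 2n_j$ and $i_j\equiv\kappa_j+\mathfrak{r}\bmod 2$ for all $j$, and $I^{(2\mathbf{n})}_{\boldsymbol{\kappa}}=I^{(2\mathbf{n})}_{\boldsymbol{\kappa},0}\cup I^{(2\mathbf{n})}_{\boldsymbol{\kappa},1}$. $\mathcal{L}(I^{(2\mathbf{n})}_{\boldsymbol{\kappa}})$ is the vector space of all functions $I^{(2\mathbf{n})}_{\boldsymbol{\kappa}}\to\mathbb{C}$. For $\mathbf{i}\in I^{(2\mathbf{n})}_{\boldsymbol{\kappa}}$ put $\mathfrak{w}^{(2\mathbf{n})}_{\boldsymbol{\kappa},\mathbf{i}}=2^{\#M}/(2^{d+1}p[\mathbf{n}])$, where $M=\{j\mid 0<i_j<2n_j\}$. The measure $\omega^{(2\mathbf{n})}_{\boldsymbol{\kappa}}$ on the power set of $I^{(2\mathbf{n})}_{\boldsymbol{\kappa}}$ is given by $\omega^{(2\mathbf{n})}_{\boldsymbol{\kappa}}(\{\mathbf{i}\})=\mathfrak{w}^{(2\mathbf{n})}_{\boldsymbol{\kappa},\mathbf{i}}$, the inner product is $\langle f_1,f_2\rangle_{\omega^{(2\mathbf{n})}_{\boldsymbol{\kappa}}}=\int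 f_1\overline{f_2}\,d\omega^{(2\mathbf{n})}_{\boldsymbol{\kappa}}=\sum_{\mathbf{i}}\mathfrak{w}^{(2\mathbf{n})}_{\boldsymbol{\kappa},\mathbf{i}}f_1(\mathbf{i})\overline{f_2(\mathbf{i})}$, and $\|\cdot\|_{\omega^{(2\mathbf{n})}_{\boldsymbol{\kappa}}}$ is the corresponding norm. For $\boldsymbol{\gamma}\in\mathbb{N}_0^d$ the function $\chi^{(2\mathbf{n})}_{\boldsymbol{\gamma}}\in\mathcal{L}(I^{(2\mathbf{n})}_{\boldsymbol{\kappa}})$ is $\chi^{(2\mathbf{n})}_{\boldsymbol{\gamma}}(\mathbf{i})=\prod_{j=1}^d\cos(\gamma_ji_j\pi/(2n_j))$. $\Gamma^{(2\mathbf{n})}_{\boldsymbol{\kappa}}$ is the union of $\{(0,\ldots,0,2n_d)\}$ and the set of all $\boldsymbol{\gamma}\in\mathbb{N}_0^d$ such that $\gamma_i<2n_i$ for all $i$, $\gamma_i/n_i+\gamma_j/n_j\le 2$ for all $i\ne j$, and $\gamma_i/n_i+\gamma_j/n_j<2$ for all $i,j$ with $\kappa_i\not\equiv\kappa_j\bmod 2$. $\mathfrak{e}(\boldsymbol{\gamma})=\#\{i\mid\gamma_i>0\}$; $\mathfrak{f}^{(2\mathbf{n})}(\boldsymbol{\gamma})=\#\{i\mid\gamma_i=n_i\}-1$ if there is an $i$ with $\gamma_i=n_i$, and $\mathfrak{f}^{(2\mathbf{n})}(\boldsymbol{\gamma})=0$ otherwise. *)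

theory Defs
  imports "HOL-Analysis.Analysis" "HOL-Library.Function_Algebras" "HOL-Number_Theory.Cong"
begin

text \<open>
  Elements of \<open>\<nat>\<^sub>0\<^sup>d\<close> are represented by functions on the index set \<open>{1..d}\<close> that are
  extensional (equal to \<open>undefined\<close> outside of it), so that equality of functions is equality of tuples.
  The parameters \<open>n\<close> and \<open>\<kappa>\<close> are plain functions; only their values on \<open>{1..d}\<close> are used.
\<close>

definition index_set_part :: "nat \<Rightarrow> (nat \<Rightarrow> nat) \<Rightarrow> (nat \<Rightarrow> int) \<Rightarrow> nat \<Rightarrow> (nat \<Rightarrow> nat) set" where
  "index_set_part d n \<kappa> r =
     {i \<in> {1..d} \<rightarrow>\<^sub>E UNIV. \<forall>j\<in>{1..d}. i j \<le> 2 * n j \<and> [int (i j) = \<kappa> j + int r] (mod 2)}"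

definition index_set :: "nat \<Rightarrow> (nat \<Rightarrow> nat) \<Rightarrow> (nat \<Rightarrow> int) \<Rightarrow> (nat \<Rightarrow> nat) set" where
  "index_set d n \<kappa> = index_set_part d n \<kappa> 0 \<union> index_set_part d n \<kappa> 1"

text \<open>
  Complex functions on a subset \<open>S\<close> of a type are represented by their extension by zero, so that
  \<open>fun_space S\<close> is a linear subspace of the space of all complex functions on that type.
\<close>

global_interpretation cfun: vector_space "\<lambda>(c::complex) (f::'a \<Rightarrow> complex) x. c * f x"
  by standard (auto simp: fun_eq_iff algebra_simps)

definition fun_space :: "'a set \<Rightarrow> ('a \<Rightarrow> complex) set" where
  "fun_space S = {f. \<forall>x. x \<notin> S \<longrightarrow> f x = 0}"

lemma subspace_fun_space: "cfun.subspace (fun_space S)"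
  by (auto simp: cfun.subspace_def fun_space_def)

text \<open>Injectivity and linear independence of the range together say that the
  \<^emph>\<open>family\<close> is linearly independent.\<close>

definition orthogonal_basis ::
    "('a \<Rightarrow> complex) set \<Rightarrow> (('a \<Rightarrow> complex) \<Rightarrow> ('a \<Rightarrow> complex) \<Rightarrow> complex) \<Rightarrow>
     'g set \<Rightarrow> ('g \<Rightarrow> 'a \<Rightarrow> complex) \<Rightarrow> bool" where
  "orthogonal_basis V ip G b \<longleftrightarrow>
     inj_on b G \<and> cfun.independent (b ` G) \<and> cfun.span (b ` G) = V \<and>
     (\<forall>g\<in>G. \<forall>h\<in>G. g \<noteq> h \<longrightarrow> ip (b g) (b h) = 0)"

definition weight :: "nat \<Rightarrow> (nat \<Rightarrow> nat) \<Rightarrow> (nat \<Rightarrow> nat) \<Rightarrow> real" where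
  "weight d n i =
     2 ^ card {j \<in> {1..d}. 0 < i j \<and> i j < 2 * n j} / (2 ^ (d + 1) * real (\<Prod>j\<in>{1..d}. n j))"

definition omega :: "nat \<Rightarrow> (nat \<Rightarrow> nat) \<Rightarrow> (nat \<Rightarrow> int) \<Rightarrow> (nat \<Rightarrow> nat) measure" where
  "omega d n \<kappa> = point_measure (index_set d n \<kappa>) (\<lambda>i. ennreal (weight d n i))"

definition omega_inner ::
    "nat \<Rightarrow> (nat \<Rightarrow> nat) \<Rightarrow> (nat \<Rightarrow> int) \<Rightarrow>
     ((nat \<Rightarrow> nat) \<Rightarrow> complex) \<Rightarrow> ((nat \<Rightarrow> nat) \<Rightarrow> complex) \<Rightarrow> complex" where
  "omega_inner d n \<kappa> f g = (\<integral>i. f i * cnj (g i) \<partial>omega d n \<kappa>)"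

definition omega_norm ::
    "nat \<Rightarrow> (nat \<Rightarrow> nat) \<Rightarrow> (nat \<Rightarrow> int) \<Rightarrow> ((nat \<Rightarrow> nat) \<Rightarrow> complex) \<Rightarrow> real" where
  "omega_norm d n \<kappa> f = sqrt (Re (omega_inner d n \<kappa> f f))"

lemma finite_index_set: "finite (index_set d n \<kappa>)"
proof -
  have "index_set d n \<kappa> \<subseteq> (\<Pi>\<^sub>E j\<in>{1..d}. {..2 * n j})"
    by (auto simp: index_set_def index_set_part_def PiE_iff extensional_def)
  then show ?thesis
    by (rule finite_subset) (simp add: finite_PiE)
qed

lemma omega_inner_eq_sum:
  "omega_inner d n \<kappa> f g = (\<Sum>i\<in>index_set d n \<kappa>. of_real (weight d n i) * (f i * cnj (g i)))"
proof -
  have "weight d n i \<ge> 0" for i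
    by (simp add: weight_def prod_nonneg)
  then show ?thesis
    unfolding omega_inner_def omega_def
    by (subst lebesgue_integral_point_measure_finite[OF finite_index_set])
       (auto simp: scaleR_conv_of_real)
qed

text \<open>Positive definiteness (sesquilinearity and Hermitian symmetry are immediate from the
  formula above).\<close>

lemma omega_inner_pos_def:
  assumes "\<forall>j\<in>{1..d}. 1 \<le> n j" and "f \<in> fun_space (index_set d n \<kappa>)" and "f \<noteq> 0"
  shows "omega_inner d n \<kappa> f f \<in> \<real>" and "Re (omega_inner d n \<kappa> f f) > 0"
proof -
  have pos: "weight d n i > 0" for i
    using assms(1) unfolding weight_def
    by (intro divide_pos_pos mult_pos_pos) (auto simp: Suc_le_eq intro!: prod_pos)
  have eq: "omega_inner d n \<kappa> f f =
      of_real (\<Sum>i\<in>index_set d n \<kappa>. weight d n i * (cmod (f i))\<^sup>2)"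
    unfolding omega_inner_eq_sum by (simp add: complex_norm_square[symmetric])
  then show "omega_inner d n \<kappa> f f \<in> \<real>" by (metis Reals_of_real)
  from assms(3) obtain i where i: "f i \<noteq> 0" by (auto simp: fun_eq_iff)
  with assms(2) have "i \<in> index_set d n \<kappa>" by (auto simp: fun_space_def)
  then have "(\<Sum>i\<in>index_set d n \<kappa>. weight d n i * (cmod (f i))\<^sup>2) > 0"
    using i pos by (intro sum_pos2[OF finite_index_set, of i]) (auto intro!: mult_nonneg_nonneg less_imp_le[OF pos])
  then show "Re (omega_inner d n \<kappa> f f) > 0" by (simp add: eq)
qed

definition chi ::
    "nat \<Rightarrow> (nat \<Rightarrow> nat) \<Rightarrow> (nat \<Rightarrow> int) \<Rightarrow> (nat \<Rightarrow> nat) \<Rightarrow> (nat \<Rightarrow> nat) \<Rightarrow> complex" where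
  "chi d n \<kappa> \<gamma> i =
     (if i \<in> index_set d n \<kappa>
      then of_real (\<Prod>j\<in>{1..d}. cos (real (\<gamma> j) * real (i j) * pi / (2 * real (n j))))
      else 0)"

definition last_tuple :: "nat \<Rightarrow> (nat \<Rightarrow> nat) \<Rightarrow> nat \<Rightarrow> nat" where
  "last_tuple d n = (\<lambda>j\<in>{1..d}. if j = d then 2 * n d else 0)"

definition Gamma_set :: "nat \<Rightarrow> (nat \<Rightarrow> nat) \<Rightarrow> (nat \<Rightarrow> int) \<Rightarrow> (nat \<Rightarrow> nat) set" where
  "Gamma_set d n \<kappa> =
     {\<gamma> \<in> {1..d} \<rightarrow>\<^sub>E UNIV.
        (\<forall>i\<in>{1..d}. \<gamma> i < 2 * n i) \<and>
        (\<forall>i\<in>{1..d}. \<forall>j\<in>{1..d}. i \<noteq> j \<longrightarrow>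
           real (\<gamma> i) / real (n i) + real (\<gamma> j) / real (n j) \<le> 2) \<and>
        (\<forall>i\<in>{1..d}. \<forall>j\<in>{1..d}. \<not> [\<kappa> i = \<kappa> j] (mod 2) \<longrightarrow>
           real (\<gamma> i) / real (n i) + real (\<gamma> j) / real (n j) < 2)}
     \<union> {last_tuple d n}"

definition e_num :: "nat \<Rightarrow> (nat \<Rightarrow> nat) \<Rightarrow> nat" where
  "e_num d \<gamma> = card {i \<in> {1..d}. \<gamma> i > 0}"

definition f_num :: "nat \<Rightarrow> (nat \<Rightarrow> nat) \<Rightarrow> (nat \<Rightarrow> nat) \<Rightarrow> nat" where
  "f_num d n \<gamma> =
     (if \<exists>i\<in>{1..d}. \<gamma> i = n i then card {i \<in> {1..d}. \<gamma> i = n i} - 1 else 0)"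

end

theory Submission
  imports Defs
begin

text \<open>
  Both parity classes of the index set are products of one-dimensional grids, and the weights and the
  functions \<open>chi\<close> factorize over the coordinates, so the inner product of two such functions is
  half the sum of two products of one-dimensional inner products, which the trapezoidal rule evaluates.
  If \<open>\<gamma> \<noteq> \<gamma>'\<close> and no factor vanishes, then \<open>\<gamma>\<^sub>j + \<gamma>'\<^sub>j = 2n\<^sub>j\<close> wherever they differ;
  by coprimality this happens for a single \<open>j\<close> only, and the two products then cancel.

  For completeness, point functions are linear combinations of all \<open>chi\<close> with \<open>\<gamma>\<^sub>j \<le> 2n\<^sub>j\<close>.
  Replacing \<open>\<gamma>\<^sub>i, \<gamma>\<^sub>j\<close> by \<open>2n\<^sub>i - \<gamma>\<^sub>i, 2n\<^sub>j - \<gamma>\<^sub>j\<close> for a pair \<open>i \<noteq> j\<close> changes \<open>chi\<close>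
  by a sign at most; a tuple minimizing \<open>\<Sum>\<^sub>j \<gamma>\<^sub>j / n\<^sub>j\<close> under these reflections lies in
  \<open>Gamma_set\<close>, is one reflection away from \<open>last_tuple\<close>, or has \<open>chi = 0\<close>.
\<close>

section \<open>Trapezoidal sums of cosines\<close>

definition parity_sign :: "int \<Rightarrow> real" where
  "parity_sign p = (if even p then 1 else - 1)"

text \<open>For \<open>i \<le> N\<close> this counts the unit intervals inside [0, N] that have
  \<open>i\<close> as an end point. It is twice the trapezoidal weight, and it turns a sum over
  nodes into a sum over intervals.\<close>

definition trap_coeff :: "nat \<Rightarrow> nat \<Rightarrow> real" where
  "trap_coeff N i = of_bool (i < N) + of_bool (0 < i)"

lemma sum_trap_coeff:
  "(\<Sum>i\<le>N. trap_coeff N i * f i) = (\<Sum>i<N. f i + f (Suc i))"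
proof -
  have "(\<Sum>i\<le>N. trap_coeff N i * f i) =
      (\<Sum>i\<le>N. of_bool (i < N) * f i) + (\<Sum>i\<le>N. of_bool (0 < i) * f i)"
    by (simp add: trap_coeff_def distrib_right sum.distrib)
  also have "(\<Sum>i\<le>N. of_bool (i < N) * f i) = (\<Sum>i<N. f i)"
    by (rule sum.mono_neutral_cong_right) auto
  also have "(\<Sum>i\<le>N. of_bool (0 < i) * f i) = (\<Sum>i<N. f (Suc i))"
    by (subst sum.atMost_shift) simp
  finally show ?thesis
    by (simp add: sum.distrib)
qed

text \<open>The sum telescopes: multiplied by \<open>sin (t / 2)\<close>, each interval yields
  \<open>cos (t / 2)\<close> times the increment of the sine across it.\<close>

lemma sin_mult_sum_cos:
  fixes t :: real
  shows "sin (t / 2) * (\<Sum>i<N. cos (real i * t) + cos (real (Suc i) * t)) = sin (real N * t) * cos (t / 2)"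
proof (induction N)
  case (Suc N)
  have *: "sin u * (cos (v - u) + cos (v + u)) = cos u * (sin (v + u) - sin (v - u))" for u v :: real
    by (simp add: cos_add cos_diff sin_add sin_diff algebra_simps)
  have "sin (t / 2) * (cos (real N * t) + cos (real (Suc N) * t)) =
      cos (t / 2) * (sin (real (Suc N) * t) - sin (real N * t))"
    using *[of "t / 2" "real N * t + t / 2"] by (simp add: algebra_simps)
  then show ?case
    using Suc.IH by (simp add: distrib_left distrib_right algebra_simps)
qed simp

text \<open>For the angle step \<open>t\<close> the number \<open>N * t\<close> is a multiple of pi,
  so the telescoped right-hand side vanishes and the sum is 0 unless \<open>sin (t / 2) = 0\<close>.
  This exception is exactly the divisibility, and there every cosine equals 1.\<close>

lemma sum_trap_cos:
  fixes m :: int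
  assumes "N \<ge> 1"
  shows "(\<Sum>i\<le>N. trap_coeff N i * cos (of_int m * real i * pi / real N)) =
    (if 2 * int N dvd m then 2 * real N else 0)"
proof -
  define t where "t = of_int m * pi / real N"
  have eq: "(\<Sum>i\<le>N. trap_coeff N i * cos (of_int m * real i * pi / real N)) =
      (\<Sum>i<N. cos (real i * t) + cos (real (Suc i) * t))"
    unfolding sum_trap_coeff by (intro sum.cong refl) (simp add: t_def field_simps)
  show ?thesis
  proof (cases "2 * int N dvd m")
    case True
    then obtain k where "m = 2 * int N * k" ..
    then have t: "t = of_int (2 * k) * pi"
      using assms by (simp add: t_def)
    have "cos (real i * t) = 1" for i
    proof -
      have "real i * t = 2 * pi * of_int (int i * k)"
        by (simp add: t)
      then show ?thesis
        by (simp only: cos_int_2pin)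
    qed
    then show ?thesis
      unfolding eq using True by (simp del: of_nat_Suc)
  next
    case False
    have "sin (t / 2) \<noteq> 0"
    proof
      assume "sin (t / 2) = 0"
      then obtain k :: int where "t / 2 = of_int k * pi"
        by (auto simp: sin_zero_iff_int2)
      then have "of_int m = (of_int (2 * int N * k) :: real)"
        using assms by (simp add: t_def field_simps)
      then have "m = 2 * int N * k"
        by (simp only: of_int_eq_iff)
      with False show False by simp
    qed
    moreover have "real N * t = of_int m * pi"
      using assms by (simp add: t_def)
    then have "sin (real N * t) = 0"
      using sin_zero_iff_int2 by blast
    ultimately have "(\<Sum>i<N. cos (real i * t) + cos (real (Suc i) * t)) = 0"
      using sin_mult_sum_cos[of t N] by simp
    then show ?thesis
      unfolding eq using False by simp
  qed
qed

section \<open>One-dimensional inner products on a parity class\<close>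

definition grid_cos :: "nat \<Rightarrow> nat \<Rightarrow> nat \<Rightarrow> real" where
  "grid_cos n a i = cos (real a * real i * pi / (2 * real n))"

lemma grid_cos_mult:
  "grid_cos n a i * grid_cos n b i =
    (cos (of_int (int a + int b) * real i * pi / real (2 * n)) +
     cos (of_int (int a - int b) * real i * pi / real (2 * n))) / 2"
  by (simp add: grid_cos_def cos_times_cos algebra_simps add_divide_distrib diff_divide_distrib)

lemma grid_cos_commute: "grid_cos n a i = grid_cos n i a"
  by (simp add: grid_cos_def mult.commute)

lemma cos_grid_shift:
  fixes m :: int
  assumes "n \<ge> 1"
  shows "cos (of_int (m + 2 * int n) * real i * pi / real (2 * n)) =
    parity_sign (int i) * cos (of_int m * real i * pi / real (2 * n))"
proof -
  have "of_int (m + 2 * int n) * real i * pi / real (2 * n) =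
      of_int m * real i * pi / real (2 * n) + real i * pi"
    using assms by (simp add: field_simps)
  then show ?thesis
    by (simp add: cos_add parity_sign_def)
qed

definition parity_grid :: "nat \<Rightarrow> int \<Rightarrow> nat set" where
  "parity_grid n p = {i. i \<le> 2 * n \<and> [int i = p] (mod 2)}"

lemma finite_parity_grid [simp]: "finite (parity_grid n p)"
  by (rule finite_subset[of _ "{..2 * n}"]) (auto simp: parity_grid_def)

lemma cong_2_iff_even: "[a = b] (mod 2) \<longleftrightarrow> (even a \<longleftrightarrow> even b)" for a b :: int
  by (auto simp: cong_def mod2_eq_if)

text \<open>The indicator of the parity class at \<open>i\<close> is
  \<open>(1 + parity_sign p * parity_sign (int i)) / 2\<close>. The alternating sign is absorbed by
  a frequency shift of \<open>2 * n\<close>, which leaves two trapezoidal sums over all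
  nodes.\<close>

lemma sum_parity_grid_cos:
  fixes m p :: int
  assumes "n \<ge> 1"
  shows "(\<Sum>i\<in>parity_grid n p. trap_coeff (2 * n) i * cos (of_int m * real i * pi / real (2 * n))) =
    2 * real n * (of_bool (4 * int n dvd m) + parity_sign p * of_bool (4 * int n dvd m + 2 * int n))"
proof -
  have "(\<Sum>i\<in>parity_grid n p. trap_coeff (2 * n) i * cos (of_int m * real i * pi / real (2 * n))) =
     (\<Sum>i\<le>2 * n. trap_coeff (2 * n) i * ((cos (of_int m * real i * pi / real (2 * n)) +
        parity_sign p * cos (of_int (m + 2 * int n) * real i * pi / real (2 * n))) / 2))"
    unfolding cos_grid_shift[OF assms]
    by (rule sum.mono_neutral_cong_left) 
      (auto simp: parity_grid_def cong_2_iff_even parity_sign_def split: if_splits)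
  also have "\<dots> = ((\<Sum>i\<le>2 * n. trap_coeff (2 * n) i * cos (of_int m * real i * pi / real (2 * n))) +
      parity_sign p * (\<Sum>i\<le>2 * n. trap_coeff (2 * n) i *
        cos (of_int (m + 2 * int n) * real i * pi / real (2 * n)))) / 2"
    unfolding sum_distrib_left sum.distrib[symmetric] sum_divide_distrib
    by (intro sum.cong refl) (simp add: algebra_simps add_divide_distrib)
  also have "\<dots> = 2 * real n * (of_bool (4 * int n dvd m) + parity_sign p * of_bool (4 * int n dvd m + 2 * int n))"
    using assms by (subst (1 2) sum_trap_cos) (auto simp: distrib_left)
  finally show ?thesis .
qed

text \<open>The factor that one axis contributes to the inner product on one part of the index set.
  For \<open>n \<ge> 1\<close> the scaling gives the constant function norm 1.\<close>

definition axis_inner :: "nat \<Rightarrow> int \<Rightarrow> nat \<Rightarrow> nat \<Rightarrow> real" where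
  "axis_inner n p a b =
     (\<Sum>i\<in>parity_grid n p. trap_coeff (2 * n) i / (2 * real n) * (grid_cos n a i * grid_cos n b i))"

lemma axis_inner_eq:
  assumes "n \<ge> 1"
  shows "axis_inner n p a b =
    (of_bool (4 * int n dvd int a + int b) + of_bool (4 * int n dvd int a - int b) +
     parity_sign p * (of_bool (4 * int n dvd int a + int b + 2 * int n) +
       of_bool (4 * int n dvd int a - int b + 2 * int n))) / 2"
proof -
  have "axis_inner n p a b =
    ((\<Sum>i\<in>parity_grid n p. trap_coeff (2 * n) i * cos (of_int (int a + int b) * real i * pi / real (2 * n))) +
     (\<Sum>i\<in>parity_grid n p. trap_coeff (2 * n) i * cos (of_int (int a - int b) * real i * pi / real (2 * n)))) / (4 * real n)"
    unfolding axis_inner_def grid_cos_mult sum.distrib[symmetric] sum_divide_distrib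
    by (intro sum.cong refl) (simp add: algebra_simps add_divide_distrib)
  moreover have "(2 * real n * (u + s * w) + 2 * real n * (v + s * x)) / (4 * real n) =
      (u + v + s * (w + x)) / 2" for u v w x s :: real
    using assms by (simp add: field_simps)
  ultimately show ?thesis
    unfolding sum_parity_grid_cos[OF assms] by simp
qed

lemma dvd_small_iff:
  fixes k m :: int
  assumes "\<bar>m\<bar> < k"
  shows "k dvd m \<longleftrightarrow> m = 0"
  using assms dvd_imp_le_int[of m k] by force

lemma dvd_small_shift_iff:
  fixes k m :: int
  assumes "0 < m" "m < 2 * k"
  shows "k dvd m \<longleftrightarrow> m = k"
proof -
  have "k dvd m \<longleftrightarrow> k dvd m - k"
    using dvd_minus_self by (metis dvd_add_triv_right_iff diff_add_cancel)
  then show ?thesis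
    using assms dvd_small_iff[of "m - k" k] by auto
qed

text \<open>Each divisibility argument ranges over an interval with at most one multiple of
  \<open>4 * n\<close>. Off the diagonal only the aliasing pairs \<open>a + b = 2 * n\<close>
  survive, with a sign that depends on the parity class.\<close>

lemma axis_inner_interior:
  assumes "a < 2 * n" "b < 2 * n"
  shows "axis_inner n p a b =
    (of_bool (a = 0 \<and> b = 0) + of_bool (a = b) + parity_sign p * of_bool (a + b = 2 * n)) / 2"
proof -
  have "4 * int n dvd int a + int b \<longleftrightarrow> a = 0 \<and> b = 0"
    using assms by (subst dvd_small_iff) auto
  moreover have "4 * int n dvd int a - int b \<longleftrightarrow> a = b"
    using assms by (subst dvd_small_iff) auto
  moreover have "4 * int n dvd int a + int b + 2 * int n \<longleftrightarrow> a + b = 2 * n"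
    using assms by (subst dvd_small_shift_iff) auto
  moreover have "\<not> 4 * int n dvd int a - int b + 2 * int n"
    using assms by (subst dvd_small_shift_iff) auto
  ultimately show ?thesis
    using assms by (subst axis_inner_eq) auto
qed

text \<open>The cosine of frequency \<open>2 * n\<close> at node \<open>i\<close> is cos(i pi), the
  constant \<open>parity_sign p\<close> on this class, so only the mean of the other factor
  matters.\<close>

lemma axis_inner_boundary:
  assumes "a < 2 * n"
  shows "axis_inner n p a (2 * n) = parity_sign p * of_bool (a = 0)"
proof -
  have "\<not> 4 * int n dvd int a + int (2 * n)"
    using assms by (subst dvd_small_shift_iff) auto
  moreover have "\<not> 4 * int n dvd int a - int (2 * n)"
    using assms by (subst dvd_small_iff) auto
  moreover have "4 * int n dvd int a + int (2 * n) + 2 * int n \<longleftrightarrow> a = 0"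
    using assms by (subst dvd_small_shift_iff) auto
  moreover have "4 * int n dvd int a - int (2 * n) + 2 * int n \<longleftrightarrow> a = 0"
    using assms by (subst dvd_small_iff) auto
  ultimately show ?thesis
    using assms by (subst axis_inner_eq) auto
qed

lemma axis_inner_boundary_self:
  assumes "n \<ge> 1"
  shows "axis_inner n p (2 * n) (2 * n) = 1"
proof -
  have "\<not> 4 * int n dvd int (2 * n) + int (2 * n) + 2 * int n"
    using assms by (subst dvd_small_shift_iff) auto
  moreover have "\<not> 4 * int n dvd int (2 * n) - int (2 * n) + 2 * int n"
    using assms by (subst dvd_small_iff) auto
  ultimately show ?thesis
    using assms by (subst axis_inner_eq) auto
qed

text \<open>The dual orthogonality: since \<open>grid_cos\<close> is symmetric in frequency and
  node, the same cosine sums, now taken over frequencies, separate the nodes. This later builds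
  point functions.\<close>

lemma sum_trap_grid_cos:
  assumes "n \<ge> 1" "i \<le> 2 * n" "p \<le> 2 * n"
  shows "(\<Sum>a\<le>2 * n. trap_coeff (2 * n) a * (grid_cos n a p * grid_cos n a i)) = 0 \<longleftrightarrow> i \<noteq> p"
proof -
  have "(\<Sum>a\<le>2 * n. trap_coeff (2 * n) a * (grid_cos n a p * grid_cos n a i)) =
      ((\<Sum>a\<le>2 * n. trap_coeff (2 * n) a * cos (of_int (int p + int i) * real a * pi / real (2 * n))) +
       (\<Sum>a\<le>2 * n. trap_coeff (2 * n) a * cos (of_int (int p - int i) * real a * pi / real (2 * n)))) / 2"
    unfolding grid_cos_commute[of n _ p] grid_cos_commute[of n _ i] grid_cos_mult
      sum.distrib[symmetric] sum_divide_distrib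
    by (intro sum.cong refl) (simp add: algebra_simps add_divide_distrib)
  also have "\<dots> = 2 * real n * (of_bool (4 * int n dvd int p + int i) + of_bool (4 * int n dvd int p - int i))"
    using assms by (subst (1 2) sum_trap_cos) auto
  also have "\<dots> = 0 \<longleftrightarrow> i \<noteq> p"
  proof -
    have "4 * int n dvd int p - int i \<longleftrightarrow> p = i"
      using assms by (subst dvd_small_iff) auto
    \<comment> \<open>\<open>p + i\<close> is at most \<open>4 * n\<close>, so it is 0 or
      \<open>4 * n\<close>, and either extreme value forces \<open>p = i\<close>.\<close>
    moreover have "p = i" if "4 * int n dvd int p + int i"
    proof (cases "int p + int i = 0")
      case False
      then have "int p + int i = 4 * int n"
        using that assms dvd_small_shift_iff[of "int p + int i" "4 * int n"] by linarith
      then show ?thesis using assms by linarith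
    qed simp
    ultimately show ?thesis using assms by auto
  qed
  finally show ?thesis .
qed

section \<open>Factorization of the inner product over the coordinates\<close>

lemma index_set_part_eq_PiE:
  "index_set_part d n \<kappa> r = (\<Pi>\<^sub>E j\<in>{1..d}. parity_grid (n j) (\<kappa> j + int r))"
  unfolding index_set_part_def parity_grid_def set_eq_iff PiE_iff by blast

text \<open>The first coordinate has different parities in the two parts. For \<open>d = 0\<close>
  both parts would consist of the empty tuple.\<close>

lemma index_set_parts_disjoint:
  assumes "1 \<le> d"
  shows "index_set_part d n \<kappa> 0 \<inter> index_set_part d n \<kappa> 1 = {}"
proof -
  have "1 \<in> {1..d}"
    using assms by simp
  then show ?thesis
    by (auto simp: index_set_part_def cong_2_iff_even simp del: atLeastAtMost_iff)
qed

lemma index_set_le: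
  assumes "x \<in> index_set d n \<kappa>" "j \<in> {1..d}"
  shows "x j \<le> 2 * n j"
  using assms by (auto simp: index_set_def index_set_part_def)

text \<open>\<open>trap_coeff\<close> is 2 at interior nodes and 1 at end points. Of the factor
  \<open>2 ^ (d + 1)\<close> in the denominator one 2 goes to each axis; the last one remains as the
  final halving and gives each part mass 1/2.\<close>

lemma weight_eq_prod:
  assumes "\<forall>j\<in>{1..d}. 1 \<le> n j" "x \<in> index_set d n \<kappa>"
  shows "weight d n x = (\<Prod>j\<in>{1..d}. trap_coeff (2 * n j) (x j) / (2 * real (n j))) / 2"
proof -
  have "(\<Prod>j\<in>{1..d}. trap_coeff (2 * n j) (x j)) =
      (\<Prod>j\<in>{1..d}. if 0 < x j \<and> x j < 2 * n j then 2 else 1)"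
  proof (intro prod.cong refl)
    fix j assume "j \<in> {1..d}"
    then have "1 \<le> n j" "x j \<le> 2 * n j"
      using assms(1) index_set_le[OF assms(2)] by blast+
    then show "trap_coeff (2 * n j) (x j) = (if 0 < x j \<and> x j < 2 * n j then 2 else 1)"
      by (auto simp: trap_coeff_def)
  qed
  also have "\<dots> = 2 ^ card {j \<in> {1..d}. 0 < x j \<and> x j < 2 * n j}"
    by (simp add: prod.inter_filter[symmetric])
  finally show ?thesis
    by (simp add: weight_def prod_dividef prod.distrib)
qed

lemma chi_eq_prod:
  assumes "x \<in> index_set d n \<kappa>"
  shows "chi d n \<kappa> \<gamma> x = of_real (\<Prod>j\<in>{1..d}. grid_cos (n j) (\<gamma> j) (x j))"
  using assms by (simp add: chi_def grid_cos_def)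

text \<open>Weight and cosines form a product over the coordinates and each part is a product of
  grids, so \<open>prod_sum_PiE\<close> makes the sum over a part a product of one-dimensional
  sums.\<close>

lemma omega_inner_chi:
  assumes "1 \<le> d" "\<forall>j\<in>{1..d}. 1 \<le> n j"
  shows "omega_inner d n \<kappa> (chi d n \<kappa> \<gamma>) (chi d n \<kappa> \<gamma>') =
    of_real (((\<Prod>j\<in>{1..d}. axis_inner (n j) (\<kappa> j) (\<gamma> j) (\<gamma>' j)) +
      (\<Prod>j\<in>{1..d}. axis_inner (n j) (\<kappa> j + 1) (\<gamma> j) (\<gamma>' j))) / 2)"
proof -
  define h where "h j i = trap_coeff (2 * n j) i / (2 * real (n j)) *
    (grid_cos (n j) (\<gamma> j) i * grid_cos (n j) (\<gamma>' j) i)" for j i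
  have part: "(\<Sum>x\<in>index_set_part d n \<kappa> r. \<Prod>j\<in>{1..d}. h j (x j)) =
      (\<Prod>j\<in>{1..d}. axis_inner (n j) (\<kappa> j + int r) (\<gamma> j) (\<gamma>' j))" for r
    unfolding index_set_part_eq_PiE axis_inner_def h_def
    by (subst prod_sum_PiE) auto
  have "omega_inner d n \<kappa> (chi d n \<kappa> \<gamma>) (chi d n \<kappa> \<gamma>') =
      (\<Sum>x\<in>index_set d n \<kappa>. of_real ((\<Prod>j\<in>{1..d}. h j (x j)) / 2))"
    unfolding omega_inner_eq_sum
  proof (intro sum.cong refl)
    fix x assume x: "x \<in> index_set d n \<kappa>"
    show "complex_of_real (weight d n x) * (chi d n \<kappa> \<gamma> x * cnj (chi d n \<kappa> \<gamma>' x)) =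
        of_real ((\<Prod>j\<in>{1..d}. h j (x j)) / 2)"
      unfolding chi_eq_prod[OF x] weight_eq_prod[OF assms(2) x] complex_cnj_complex_of_real
        of_real_mult[symmetric] h_def prod.distrib by simp
  qed
  also have "\<dots> = of_real (((\<Sum>x\<in>index_set_part d n \<kappa> 0. \<Prod>j\<in>{1..d}. h j (x j)) +
      (\<Sum>x\<in>index_set_part d n \<kappa> 1. \<Prod>j\<in>{1..d}. h j (x j))) / 2)"
    unfolding index_set_def of_real_sum[symmetric] sum_divide_distrib[symmetric]
    by (subst sum.union_disjoint)
      (use finite_index_set[of d n \<kappa>] index_set_parts_disjoint[OF assms(1)]
        in \<open>auto simp: index_set_def\<close>)
  finally show ?thesis
    unfolding part by (simp only: of_nat_0 of_nat_1 add_0_right)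
qed

section \<open>Orthogonality and norms\<close>

text \<open>Cleared of denominators, the equation shows that \<open>n\<close> divides
  \<open>a * m\<close>, hence \<open>a\<close> by coprimality. So \<open>a\<close> is 0,
  \<open>n\<close> or \<open>2 * n\<close>, and the equation then determines
  \<open>b\<close>.\<close>

lemma frequency_tie:
  assumes "coprime n m" "1 \<le> n" "1 \<le> m" "a \<le> 2 * n" "b \<le> 2 * m"
    and "real a / real n + real b / real m = 2"
  shows "a = 0 \<and> b = 2 * m \<or> a = n \<and> b = m \<or> a = 2 * n \<and> b = 0"
proof -
  have "real a * real m + real b * real n = 2 * real n * real m"
    using assms(2,3,6) by (simp add: field_simps)
  then have "real (a * m + b * n) = real (2 * n * m)"
    by simp
  then have eq: "a * m + b * n = 2 * n * m"
    by (simp only: of_nat_eq_iff)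
  then have "n dvd a * m + b * n"
    by simp
  then have "n dvd a * m"
    by (simp add: dvd_add_left_iff)
  then have "n dvd a"
    using assms(1) by (simp add: coprime_dvd_mult_left_iff)
  then obtain k where k: "a = n * k" ..
  then have "k \<le> 2"
    using assms by simp
  then have "k = 0 \<or> k = 1 \<or> k = 2"
    by linarith
  moreover have "n * (k * m + b) = n * (2 * m)"
    using eq k by (simp add: algebra_simps)
  then have "k * m + b = 2 * m"
    using assms(2) by simp
  ultimately show ?thesis
    using k by auto
qed

lemma Gamma_set_cases:
  assumes "\<gamma> \<in> Gamma_set d n \<kappa>" "\<gamma> \<noteq> last_tuple d n"
  shows "\<gamma> \<in> {1..d} \<rightarrow>\<^sub>E UNIV"
    and "\<And>i. i \<in> {1..d} \<Longrightarrow> \<gamma> i < 2 * n i"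
    and "\<And>i j. i \<in> {1..d} \<Longrightarrow> j \<in> {1..d} \<Longrightarrow> i \<noteq> j \<Longrightarrow>
      real (\<gamma> i) / real (n i) + real (\<gamma> j) / real (n j) \<le> 2"
    and "\<And>i j. i \<in> {1..d} \<Longrightarrow> j \<in> {1..d} \<Longrightarrow> \<not> [\<kappa> i = \<kappa> j] (mod 2) \<Longrightarrow>
      real (\<gamma> i) / real (n i) + real (\<gamma> j) / real (n j) < 2"
proof -
  note * = assms[unfolded Gamma_set_def Un_iff mem_Collect_eq singleton_iff]
  show "\<gamma> \<in> {1..d} \<rightarrow>\<^sub>E UNIV"
    using * by blast
  show "\<And>i. i \<in> {1..d} \<Longrightarrow> \<gamma> i < 2 * n i"
    using * by blast
  show "\<And>i j. i \<in> {1..d} \<Longrightarrow> j \<in> {1..d} \<Longrightarrow> i \<noteq> j \<Longrightarrow>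
      real (\<gamma> i) / real (n i) + real (\<gamma> j) / real (n j) \<le> 2"
    using * by blast
  show "\<And>i j. i \<in> {1..d} \<Longrightarrow> j \<in> {1..d} \<Longrightarrow> \<not> [\<kappa> i = \<kappa> j] (mod 2) \<Longrightarrow>
      real (\<gamma> i) / real (n i) + real (\<gamma> j) / real (n j) < 2"
    using * by blast
qed

lemma parity_sign_add_1 [simp]: "parity_sign (p + 1) = - parity_sign p"
  by (simp add: parity_sign_def)

lemma parity_sign_mult_self [simp]: "parity_sign p * parity_sign p = 1"
  by (simp add: parity_sign_def)

text \<open>For \<open>a = n\<close> the values are cos(i pi / 2), which vanish at odd nodes and
  have modulus 1 at even ones. Only this case distinguishes the parity classes.\<close>

lemma axis_inner_self:
  assumes "a < 2 * n"
  shows "axis_inner n p a a =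
    (if a = 0 then 1 else if a = n then of_bool (even p) else 1 / 2)"
  using assms by (auto simp: axis_inner_interior parity_sign_def)

lemma omega_inner_chi_last_self:
  assumes "1 \<le> d" "\<forall>j\<in>{1..d}. 1 \<le> n j"
  shows "omega_inner d n \<kappa> (chi d n \<kappa> (last_tuple d n)) (chi d n \<kappa> (last_tuple d n)) = 1"
proof -
  have "axis_inner (n j) p (last_tuple d n j) (last_tuple d n j) = 1" if "j \<in> {1..d}" for j p
    using that assms(2) by (auto simp: last_tuple_def axis_inner_boundary_self axis_inner_self Suc_le_eq)
  then show ?thesis
    by (simp add: omega_inner_chi[OF assms])
qed

text \<open>The function of \<open>last_tuple\<close> is constant on each part, with opposite signs
  on the two parts, while all factors off the axis \<open>d\<close> agree on both parts. So the two
  products cancel.\<close>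

lemma omega_inner_chi_last:
  assumes "1 \<le> d" "\<forall>j\<in>{1..d}. 1 \<le> n j" "\<And>j. j \<in> {1..d} \<Longrightarrow> \<gamma> j < 2 * n j"
  shows "omega_inner d n \<kappa> (chi d n \<kappa> \<gamma>) (chi d n \<kappa> (last_tuple d n)) = 0"
proof -
  have d: "d \<in> {1..d}"
    using assms(1) by simp
  let ?T = "\<lambda>p j. axis_inner (n j) p (\<gamma> j) (last_tuple d n j)"
  have T_d: "?T p d = parity_sign p * of_bool (\<gamma> d = 0)" for p
    using axis_inner_boundary[OF assms(3)[OF d]] d by (simp add: last_tuple_def)
  have "?T p j = of_bool (\<gamma> j = 0)" if "j \<in> {1..d} - {d}" for p j
    using that assms(2) assms(3)[of j] by (auto simp: last_tuple_def axis_inner_interior)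
  then have "(\<Prod>j\<in>{1..d} - {d}. ?T (\<kappa> j + 1) j) = (\<Prod>j\<in>{1..d} - {d}. ?T (\<kappa> j) j)"
    by (intro prod.cong) auto
  then show ?thesis
    unfolding omega_inner_chi[OF assms(1,2)]
    by (simp only: prod.remove[OF finite_atLeastAtMost d] T_d) simp
qed

lemma omega_inner_commute:
  "omega_inner d n \<kappa> g f = cnj (omega_inner d n \<kappa> f g)"
  by (simp add: omega_inner_eq_sum mult.commute)

text \<open>Coordinates in \<open>P - M\<close> contribute 1/2 each, those in \<open>M\<close> the
  indicator of an even parity, all others 1. Without \<open>M\<close> both parts contribute equally;
  otherwise exactly one part survives, and averaging costs one more factor 1/2.\<close>

lemma omega_inner_chi_self:
  assumes "1 \<le> d" "\<forall>j\<in>{1..d}. 1 \<le> n j"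
    and "pairwise (\<lambda>i j. coprime (n i) (n j)) {1..d}"
    and "\<gamma> \<in> Gamma_set d n \<kappa>" "\<gamma> \<noteq> last_tuple d n"
  shows "omega_inner d n \<kappa> (chi d n \<kappa> \<gamma>) (chi d n \<kappa> \<gamma>) =
    of_real (2 powi (- int (e_num d \<gamma>) + int (f_num d n \<gamma>)))"
proof -
  note \<gamma> = Gamma_set_cases[OF assms(4,5)]
  define P where "P = {j \<in> {1..d}. \<gamma> j > 0}"
  define M where "M = {j \<in> {1..d}. \<gamma> j = n j}"
  have fin: "finite P" "finite M" "M \<subseteq> P"
    using assms(2) by (auto simp: P_def M_def Suc_le_eq)
  have prod_eq: "(\<Prod>j\<in>{1..d}. axis_inner (n j) (\<kappa> j + r) (\<gamma> j) (\<gamma> j)) =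
      (1 / 2) ^ card (P - M) * of_bool (\<forall>j\<in>M. even (\<kappa> j + r))" for r
  proof -
    have "(\<Prod>j\<in>{1..d}. axis_inner (n j) (\<kappa> j + r) (\<gamma> j) (\<gamma> j)) =
        (\<Prod>j\<in>{1..d}. (if j \<in> P - M then 1 / 2 else 1) * (if j \<in> M then of_bool (even (\<kappa> j + r)) else 1))"
    proof (intro prod.cong refl)
      fix j assume j: "j \<in> {1..d}"
      then have "n j \<noteq> 0"
        using assms(2) by fastforce
      then show "axis_inner (n j) (\<kappa> j + r) (\<gamma> j) (\<gamma> j) =
          (if j \<in> P - M then 1 / 2 else 1) * (if j \<in> M then of_bool (even (\<kappa> j + r)) else 1)"
        using axis_inner_self[OF \<gamma>(2)[OF j]] j by (auto simp: P_def M_def)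
    qed
    also have "\<dots> = (\<Prod>j\<in>P - M. 1 / 2) * (\<Prod>j\<in>M. of_bool (even (\<kappa> j + r)))"
    proof -
      have "{1..d} \<inter> (P - M) = P - M" "{1..d} \<inter> M = M"
        by (auto simp: P_def M_def)
      then show ?thesis
        unfolding prod.distrib
        by (simp only: prod.inter_restrict[OF finite_atLeastAtMost, symmetric])
    qed
    also have "(\<Prod>j\<in>M. of_bool (even (\<kappa> j + r))) = (of_bool (\<forall>j\<in>M. even (\<kappa> j + r)) :: real)"
      using fin(2) by (auto simp: prod_zero_iff of_bool_def intro!: prod.neutral)
    finally show ?thesis
      by simp
  qed
  have cardPM: "card P = card (P - M) + card M"
    using fin by (simp add: card_Diff_subset card_mono)
  have half_power: "(1 / 2) ^ k = (2 :: real) powi - int k" for k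
    by (simp only: power_int_minus power_int_of_nat power_one_over inverse_eq_divide)
  have e: "e_num d \<gamma> = card P"
    by (simp add: e_num_def P_def)
  have "((\<Prod>j\<in>{1..d}. axis_inner (n j) (\<kappa> j) (\<gamma> j) (\<gamma> j)) +
      (\<Prod>j\<in>{1..d}. axis_inner (n j) (\<kappa> j + 1) (\<gamma> j) (\<gamma> j))) / 2 =
      2 powi (- int (e_num d \<gamma>) + int (f_num d n \<gamma>))"
  proof (cases "M = {}")
    case True
    then have "f_num d n \<gamma> = 0"
      by (auto simp: f_num_def M_def)
    moreover have "(\<Prod>j\<in>{1..d}. axis_inner (n j) (\<kappa> j + r) (\<gamma> j) (\<gamma> j)) = 2 powi - int (card P)" for r
      unfolding prod_eq half_power using True by simp
    from this[of 0] this[of 1]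
    have "((\<Prod>j\<in>{1..d}. axis_inner (n j) (\<kappa> j) (\<gamma> j) (\<gamma> j)) +
        (\<Prod>j\<in>{1..d}. axis_inner (n j) (\<kappa> j + 1) (\<gamma> j) (\<gamma> j))) / 2 = 2 powi - int (card P)"
      by (simp only: add_0_right) simp
    ultimately show ?thesis
      by (simp only: e of_nat_0 add_0_right)
  next
    case False
    then obtain m where m: "m \<in> M" by auto
    have in_M: "j \<in> {1..d}" "real (\<gamma> j) / real (n j) = 1" if "j \<in> M" for j
    proof -
      show j: "j \<in> {1..d}"
        using that unfolding M_def by blast
      then have "1 \<le> n j"
        using assms(2) by blast
      then show "real (\<gamma> j) / real (n j) = 1"
        using that by (simp add: M_def)
    qed
    \<comment> \<open>The two quotients add up to 2, which the strict inequality in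
      \<open>Gamma_set\<close> excludes for unequal parities.\<close>
    have "[\<kappa> j = \<kappa> m] (mod 2)" if "j \<in> M" for j
      using \<gamma>(4)[OF in_M(1)[OF that] in_M(1)[OF m]] in_M(2)[OF that] in_M(2)[OF m] by linarith
    then have all: "(\<forall>j\<in>M. even (\<kappa> j + r)) \<longleftrightarrow> even (\<kappa> m + r)" for r
      using m unfolding cong_2_iff_even even_add by metis
    have "\<exists>i\<in>{1..d}. \<gamma> i = n i"
      using m by (auto simp: M_def)
    then have f: "f_num d n \<gamma> = card M - 1"
      by (simp add: f_num_def M_def)
    have "card M > 0"
      using m fin by (auto simp: card_gt_0_iff)
    \<comment> \<open>The truncated difference \<open>card M - 1\<close> is a true one because
      \<open>M\<close> is nonempty; the resulting extra factor 1/2 is the averaging over two parts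
      of which one vanishes.\<close>
    then have "- int (e_num d \<gamma>) + int (f_num d n \<gamma>) = - int (Suc (card (P - M)))"
      using cardPM by (simp add: f e)
    moreover have "((\<Prod>j\<in>{1..d}. axis_inner (n j) (\<kappa> j) (\<gamma> j) (\<gamma> j)) +
        (\<Prod>j\<in>{1..d}. axis_inner (n j) (\<kappa> j + 1) (\<gamma> j) (\<gamma> j))) / 2 = (1 / 2) ^ Suc (card (P - M))"
      using prod_eq[of 0] prod_eq[of 1] all[of 0] all[of 1] by simp
    ultimately show ?thesis
      by (simp only: half_power)
  qed
  then show ?thesis
    unfolding omega_inner_chi[OF assms(1,2)] by (simp only:)
qed

lemma omega_inner_chi_distinct:
  assumes "1 \<le> d" "\<forall>j\<in>{1..d}. 1 \<le> n j"
    and "pairwise (\<lambda>i j. coprime (n i) (n j)) {1..d}"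
    and "\<gamma> \<in> Gamma_set d n \<kappa>" "\<gamma> \<noteq> last_tuple d n"
    and "\<gamma>' \<in> Gamma_set d n \<kappa>" "\<gamma>' \<noteq> last_tuple d n"
    and "\<gamma> \<noteq> \<gamma>'"
  shows "omega_inner d n \<kappa> (chi d n \<kappa> \<gamma>) (chi d n \<kappa> \<gamma>') = 0"
proof -
  note \<gamma> = Gamma_set_cases[OF assms(4,5)]
  note \<gamma>' = Gamma_set_cases[OF assms(6,7)]
  let ?T = "\<lambda>r j. axis_inner (n j) (\<kappa> j + r) (\<gamma> j) (\<gamma>' j)"
  obtain k where k: "k \<in> {1..d}" "\<gamma> k \<noteq> \<gamma>' k"
    using PiE_ext[OF \<gamma>(1) \<gamma>'(1)] assms(8) by blast
  \<comment> \<open>Off the diagonal only the aliasing term is left, and its sign flips with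
    \<open>r\<close>.\<close>
  have T_k: "?T r k = parity_sign (\<kappa> k + r) * of_bool (\<gamma> k + \<gamma>' k = 2 * n k) / 2" for r
    using k \<gamma>(2) \<gamma>'(2) by (subst axis_inner_interior) auto
  have "(\<Prod>j\<in>{1..d}. ?T 0 j) + (\<Prod>j\<in>{1..d}. ?T 1 j) = 0"
  proof (cases "\<exists>j\<in>{1..d}. \<gamma> j \<noteq> \<gamma>' j \<and> \<gamma> j + \<gamma>' j \<noteq> 2 * n j")
    case True
    then obtain j where j: "j \<in> {1..d}" "\<gamma> j \<noteq> \<gamma>' j" "\<gamma> j + \<gamma>' j \<noteq> 2 * n j"
      by blast
    then have "?T r j = 0" for r
      using \<gamma>(2) \<gamma>'(2) by (subst axis_inner_interior) auto
    then have "(\<Prod>j\<in>{1..d}. ?T r j) = 0" for r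
      using prod_zero[OF finite_atLeastAtMost, of 1 d "?T r"] j(1) by blast
    then show ?thesis by (simp only: add_0)
  next
    case False
    then have sum_k: "\<gamma> k + \<gamma>' k = 2 * n k"
      using k by blast
    \<comment> \<open>At \<open>j\<close> and \<open>k\<close> the quotients of both tuples would
      total 4, while each tuple is bounded by 2, so both bounds are attained and
      \<open>frequency_tie\<close> forces \<open>\<gamma> k = n k = \<gamma>' k\<close>. This also
      rules out \<open>\<gamma> j = \<gamma>' j = n j\<close>, where the factor would depend on the
      part.\<close>
    have not_both: "\<gamma> j + \<gamma>' j \<noteq> 2 * n j" if j: "j \<in> {1..d}" "j \<noteq> k" for j
    proof
      assume sum_j: "\<gamma> j + \<gamma>' j = 2 * n j"
      have pos: "n j \<ge> 1" "n k \<ge> 1"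
        using assms(2) j k by auto
      have "real (\<gamma> i) / real (n i) + real (\<gamma>' i) / real (n i) = 2" if "\<gamma> i + \<gamma>' i = 2 * n i" "n i \<ge> 1" for i
        using that(2) arg_cong[OF that(1), of real] by (simp add: field_simps)
      from this[OF sum_j pos(1)] this[OF sum_k pos(2)] \<gamma>(3)[OF j(1) k(1) j(2)] \<gamma>'(3)[OF j(1) k(1) j(2)]
      have "real (\<gamma> j) / real (n j) + real (\<gamma> k) / real (n k) = 2"
        by linarith
      moreover have "coprime (n j) (n k)"
        using assms(3) j k by (auto simp: pairwise_def)
      ultimately have "\<gamma> k = n k"
        using frequency_tie[of "n j" "n k" "\<gamma> j" "\<gamma> k"] pos \<gamma>(2)[OF j(1)] \<gamma>(2)[OF k(1)] by simp
      with sum_k k(2) show False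
        by simp
    qed
    \<comment> \<open>Without aliasing away from \<open>k\<close>, only the factor at
      \<open>k\<close> differs between the parts, by its sign.\<close>
    have "(\<Prod>j\<in>{1..d} - {k}. ?T 1 j) = (\<Prod>j\<in>{1..d} - {k}. ?T 0 j)"
    proof (intro prod.cong refl)
      fix j assume "j \<in> {1..d} - {k}"
      then show "?T 1 j = ?T 0 j"
        using not_both[of j] \<gamma>(2)[of j] \<gamma>'(2)[of j] by (simp add: axis_inner_interior)
    qed
    then show ?thesis
      by (simp only: prod.remove[OF finite_atLeastAtMost k(1)] T_k) simp
  qed
  then show ?thesis
    unfolding omega_inner_chi[OF assms(1,2)] by simp
qed

section \<open>Reflections of frequencies\<close>

lemma sum_fun_apply: "(\<Sum>a\<in>A. f a) x = (\<Sum>a\<in>A. f a x)"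
  by (induction A rule: infinite_finite_induct) auto

lemma grid_cos_reflect:
  assumes "1 \<le> n" "a \<le> 2 * n"
  shows "grid_cos n (2 * n - a) i = parity_sign (int i) * grid_cos n a i"
proof -
  have "real (2 * n - a) * real i * pi / (2 * real n) = real i * pi - real a * real i * pi / (2 * real n)"
    using assms by (simp add: of_nat_diff field_simps)
  then show ?thesis
    by (simp add: grid_cos_def cos_diff parity_sign_def)
qed

text \<open>Reflecting one coordinate multiplies by \<open>parity_sign (int (x i))\<close>, which
  depends on the part. For a pair the dependence cancels: on both parts \<open>x i + x j\<close> has
  the parity of \<open>\<kappa> i + \<kappa> j\<close>.\<close>

lemma chi_reflect:
  assumes "\<forall>j\<in>{1..d}. 1 \<le> n j" "i \<in> {1..d}" "j \<in> {1..d}" "i \<noteq> j"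
    and "\<gamma> i \<le> 2 * n i" "\<gamma> j \<le> 2 * n j"
  shows "chi d n \<kappa> (\<gamma>(i := 2 * n i - \<gamma> i, j := 2 * n j - \<gamma> j)) =
    (\<lambda>x. of_real (parity_sign (\<kappa> i + \<kappa> j)) * chi d n \<kappa> \<gamma> x)"
proof
  fix x
  let ?\<gamma> = "\<gamma>(i := 2 * n i - \<gamma> i, j := 2 * n j - \<gamma> j)"
  show "chi d n \<kappa> ?\<gamma> x = of_real (parity_sign (\<kappa> i + \<kappa> j)) * chi d n \<kappa> \<gamma> x"
  proof (cases "x \<in> index_set d n \<kappa>")
    case True
    have "even (int (x i) + int (x j)) \<longleftrightarrow> even (\<kappa> i + \<kappa> j)"
      using True assms(2,3) unfolding index_set_def index_set_part_def
      by (force simp: cong_2_iff_even)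
    then have sgn: "parity_sign (int (x i)) * parity_sign (int (x j)) = parity_sign (\<kappa> i + \<kappa> j)"
      by (auto simp: parity_sign_def)
    have ji: "j \<in> {1..d} - {i}"
      using assms by blast
    have split: "prod g {1..d} = g i * (g j * prod g ({1..d} - {i} - {j}))" for g :: "nat \<Rightarrow> real"
      unfolding prod.remove[OF finite_atLeastAtMost assms(2), of g]
      by (subst prod.remove[OF _ ji]) simp_all
    have "(\<Prod>k\<in>{1..d}. grid_cos (n k) (?\<gamma> k) (x k)) =
        grid_cos (n i) (2 * n i - \<gamma> i) (x i) * (grid_cos (n j) (2 * n j - \<gamma> j) (x j) *
        (\<Prod>k\<in>{1..d} - {i} - {j}. grid_cos (n k) (\<gamma> k) (x k)))"
      unfolding split using assms(4) by simp
    also have "\<dots> = parity_sign (\<kappa> i + \<kappa> j) * (grid_cos (n i) (\<gamma> i) (x i) *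
        (grid_cos (n j) (\<gamma> j) (x j) * (\<Prod>k\<in>{1..d} - {i} - {j}. grid_cos (n k) (\<gamma> k) (x k))))"
      using assms unfolding sgn[symmetric] by (simp add: grid_cos_reflect)
    also have "\<dots> = parity_sign (\<kappa> i + \<kappa> j) * (\<Prod>k\<in>{1..d}. grid_cos (n k) (\<gamma> k) (x k))"
      by (simp only: split)
    finally show ?thesis
      unfolding chi_eq_prod[OF True] by (simp only: of_real_mult)
  qed (simp add: chi_def)
qed

lemma chi_in_span_if_reflect:
  assumes "\<forall>j\<in>{1..d}. 1 \<le> n j" "i \<in> {1..d}" "j \<in> {1..d}" "i \<noteq> j"
    and "\<gamma> i \<le> 2 * n i" "\<gamma> j \<le> 2 * n j"
    and "chi d n \<kappa> (\<gamma>(i := 2 * n i - \<gamma> i, j := 2 * n j - \<gamma> j)) \<in> cfun.span B"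
  shows "chi d n \<kappa> \<gamma> \<in> cfun.span B"
proof -
  let ?s = "complex_of_real (parity_sign (\<kappa> i + \<kappa> j))"
  have "(\<lambda>x. ?s * (?s * chi d n \<kappa> \<gamma> x)) \<in> cfun.span B"
    using cfun.span_scale[OF assms(7), of ?s] unfolding chi_reflect[OF assms(1-6)] .
  moreover have "?s * (?s * z) = z" for z
    by (simp add: parity_sign_def)
  ultimately show ?thesis by simp
qed

lemma chi_in_span_Gamma:
  assumes "1 \<le> d" "\<forall>j\<in>{1..d}. 1 \<le> n j"
    and "pairwise (\<lambda>i j. coprime (n i) (n j)) {1..d}"
    and "\<gamma> \<in> (\<Pi>\<^sub>E j\<in>{1..d}. {..2 * n j})"
  shows "chi d n \<kappa> \<gamma> \<in> cfun.span (chi d n \<kappa> ` Gamma_set d n \<kappa>)"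
proof (rule ccontr)
  let ?B = "chi d n \<kappa> ` Gamma_set d n \<kappa>"
  \<comment> \<open>The counterexamples, among which \<open>\<beta>\<close> will minimize
    \<open>h\<close>. Reflections of pairs preserve \<open>X\<close>, as they change the function by
    a sign only.\<close>
  define X where "X = {\<gamma> \<in> (\<Pi>\<^sub>E j\<in>{1..d}. {..2 * n j}). chi d n \<kappa> \<gamma> \<notin> cfun.span ?B}"
  define h where "h \<gamma> = (\<Sum>j\<in>{1..d}. real (\<gamma> j) / real (n j))" for \<gamma>
  assume "chi d n \<kappa> \<gamma> \<notin> cfun.span ?B"
  then have "\<gamma> \<in> X"
    using assms(4) by (simp add: X_def)
  moreover have "finite X"
    unfolding X_def by (rule finite_subset[OF _ finite_PiE[of "{1..d}" "\<lambda>j. {..2 * n j}"]]) auto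
  ultimately obtain \<beta> where \<beta>: "\<beta> \<in> X" "\<And>\<alpha>. \<alpha> \<in> X \<Longrightarrow> h \<beta> \<le> h \<alpha>"
    using ex_min_if_finite[of "h ` X"] by (metis empty_iff finite_imageI imageE imageI image_is_empty not_less)
  have \<beta>_PiE: "\<beta> \<in> (\<Pi>\<^sub>E j\<in>{1..d}. {..2 * n j})" and not_span: "chi d n \<kappa> \<beta> \<notin> cfun.span ?B"
    using \<beta>(1) by (auto simp: X_def)
  have le: "\<beta> j \<le> 2 * n j" if "j \<in> {1..d}" for j
    using \<beta>_PiE that by (auto simp: PiE_iff)
  have pos: "n j \<ge> 1" if "j \<in> {1..d}" for j
    using assms(2) that by blast
  have reflect_X: "\<beta>(i := 2 * n i - \<beta> i, j := 2 * n j - \<beta> j) \<in> X"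
    if "i \<in> {1..d}" "j \<in> {1..d}" "i \<noteq> j" for i j
  proof -
    have "\<beta>(i := 2 * n i - \<beta> i, j := 2 * n j - \<beta> j) \<in> (\<Pi>\<^sub>E j\<in>{1..d}. {..2 * n j})"
      using \<beta>_PiE that by (auto simp: PiE_iff extensional_def)
    then show ?thesis
      using chi_in_span_if_reflect[where \<gamma> = \<beta>, OF assms(2) that le[OF that(1)] le[OF that(2)]] not_span
      by (auto simp: X_def)
  qed
  \<comment> \<open>Reflecting the pair adds 4 minus twice this sum to \<open>h\<close>, which is
    nonnegative by minimality.\<close>
  have sum_le: "real (\<beta> i) / real (n i) + real (\<beta> j) / real (n j) \<le> 2"
    if ij: "i \<in> {1..d}" "j \<in> {1..d}" "i \<noteq> j" for i j
  proof -
    let ?\<beta> = "\<beta>(i := 2 * n i - \<beta> i, j := 2 * n j - \<beta> j)"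
    have ji: "j \<in> {1..d} - {i}"
      using ij by blast
    have refl: "real (2 * n k - \<beta> k) / real (n k) = 2 - real (\<beta> k) / real (n k)" if "k \<in> {1..d}" for k
      using le[OF that] pos[OF that] by (simp add: of_nat_diff field_simps)
    have split: "h \<alpha> = real (\<alpha> i) / real (n i) + (real (\<alpha> j) / real (n j) +
        (\<Sum>k\<in>{1..d} - {i} - {j}. real (\<alpha> k) / real (n k)))" for \<alpha>
      unfolding h_def sum.remove[OF finite_atLeastAtMost ij(1)]
      by (subst sum.remove[OF _ ji]) simp_all
    have "h \<beta> \<le> h ?\<beta>"
      using \<beta>(2) reflect_X[OF ij] by blast
    moreover have "(\<Sum>k\<in>{1..d} - {i} - {j}. real (?\<beta> k) / real (n k)) =
        (\<Sum>k\<in>{1..d} - {i} - {j}. real (\<beta> k) / real (n k))"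
      by (intro sum.cong) auto
    ultimately show ?thesis
      using ij(3) refl[OF ij(1)] refl[OF ij(2)] by (simp add: split)
  qed
  consider (boundary) i where "i \<in> {1..d}" "\<beta> i = 2 * n i"
    | (interior) "\<And>i. i \<in> {1..d} \<Longrightarrow> \<beta> i < 2 * n i"
    using le by (meson le_neq_implies_less)
  then show False
  proof cases
    case boundary
    \<comment> \<open>The quotient at \<open>i\<close> already uses up the whole bound 2.\<close>
    have zero: "\<beta> j = 0" if "j \<in> {1..d}" "j \<noteq> i" for j
    proof -
      have "real (\<beta> j) / real (n j) \<le> 0"
        using sum_le[OF boundary(1) that(1)] that(2) boundary pos[OF boundary(1)] by simp
      then show ?thesis
        using pos[OF that(1)] by (simp add: divide_le_0_iff)
    qed
    have d: "d \<in> {1..d}"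
      using assms(1) by simp
    have last: "last_tuple d n \<in> X \<Longrightarrow> False"
      by (auto simp: X_def Gamma_set_def intro: cfun.span_base)
    have ext: "\<beta> \<in> extensional {1..d}"
      using \<beta>_PiE by (simp add: PiE_iff)
    show False
    proof (cases "i = d")
      case True
      have "\<beta> = last_tuple d n"
        by (rule extensionalityI[OF ext]) (use zero boundary True in \<open>auto simp: last_tuple_def\<close>)
      then show False
        using \<beta>(1) last by simp
    next
      case False
      \<comment> \<open>The only nonzero entry moves from position \<open>i\<close> to position
        \<open>d\<close>.\<close>
      have "\<beta>(i := 2 * n i - \<beta> i, d := 2 * n d - \<beta> d) = last_tuple d n"
        by (rule extensionalityI[where A = "{1..d}"])
          (use zero boundary False d ext in \<open>auto simp: last_tuple_def extensional_def\<close>)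
      then show False
        using reflect_X[OF boundary(1) d False] last by simp
    qed
  next
    case interior
    have "\<beta> \<notin> Gamma_set d n \<kappa>"
      using not_span by (auto intro: cfun.span_base)
    moreover have "\<beta> \<in> {1..d} \<rightarrow>\<^sub>E UNIV"
      using \<beta>_PiE by (simp add: PiE_iff)
    \<comment> \<open>\<open>interior\<close> and \<open>sum_le\<close> give the first two
      conditions of \<open>Gamma_set\<close>, so the third fails for some pair. By
      \<open>sum_le\<close> it fails with equality, which \<open>frequency_tie\<close>
      resolves.\<close>
    ultimately obtain i j where ij: "i \<in> {1..d}" "j \<in> {1..d}" "\<not> [\<kappa> i = \<kappa> j] (mod 2)"
      "\<not> real (\<beta> i) / real (n i) + real (\<beta> j) / real (n j) < 2"
      using interior sum_le unfolding Gamma_set_def by blast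
    then have "i \<noteq> j"
      by auto
    then have "real (\<beta> i) / real (n i) + real (\<beta> j) / real (n j) = 2"
      using ij sum_le[OF ij(1,2)] by linarith
    moreover have "coprime (n i) (n j)"
      using assms(3) ij(1,2) \<open>i \<noteq> j\<close> by (simp add: pairwise_def)
    ultimately have "\<beta> i = n i \<and> \<beta> j = n j"
      using frequency_tie[of "n i" "n j" "\<beta> i" "\<beta> j"] pos[OF ij(1)] pos[OF ij(2)]
        interior[OF ij(1)] interior[OF ij(2)]
      by linarith
    then have eq: "\<beta> i = n i" "\<beta> j = n j"
      by blast+
    \<comment> \<open>The reflection fixes \<open>\<beta>\<close> but multiplies its function by -1,
      so the function is zero and lies in every span.\<close>
    have fixed: "\<beta>(i := 2 * n i - \<beta> i, j := 2 * n j - \<beta> j) = \<beta>"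
      using eq by (simp add: fun_eq_iff)
    have sign: "parity_sign (\<kappa> i + \<kappa> j) = - 1"
      using ij(3) unfolding parity_sign_def cong_2_iff_even even_add by argo
    have "chi d n \<kappa> \<beta> x = - chi d n \<kappa> \<beta> x" for x
      using fun_cong[OF chi_reflect[OF assms(2) ij(1,2) \<open>i \<noteq> j\<close> le[OF ij(1)] le[OF ij(2)], of \<kappa>], of x]
      unfolding fixed sign of_real_minus of_real_1 mult_minus1 .
    then have "chi d n \<kappa> \<beta> = 0"
      unfolding complex_eq_iff uminus_complex.sel equal_neg_zero
      by (simp add: fun_eq_iff complex_eq_iff)
    then show False
      using not_span cfun.span_zero by metis
  qed
qed

section \<open>Point functions and completeness\<close>

lemma index_set_PiE:
  assumes "x \<in> index_set d n \<kappa>"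
  shows "x \<in> {1..d} \<rightarrow>\<^sub>E UNIV"
  using assms unfolding index_set_def index_set_part_def by blast

text \<open>The product \<open>D\<close> of the one-dimensional sums of
  \<open>sum_trap_grid_cos\<close> vanishes on the index set exactly off \<open>p\<close>. Expanded
  by \<open>prod_sum_PiE\<close> it is a combination of functions \<open>chi\<close> with
  coefficients \<open>c\<close>; division by \<open>D p\<close> normalizes it.\<close>

lemma point_function_in_span:
  assumes "\<forall>j\<in>{1..d}. 1 \<le> n j" "p \<in> index_set d n \<kappa>"
    and "\<And>\<gamma>. \<gamma> \<in> (\<Pi>\<^sub>E j\<in>{1..d}. {..2 * n j}) \<Longrightarrow> chi d n \<kappa> \<gamma> \<in> cfun.span B"
  shows "(\<lambda>x. of_bool (x = p)) \<in> cfun.span B"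
proof -
  let ?R = "\<Pi>\<^sub>E j\<in>{1..d}. {..2 * n j}"
  define t where "t j a i = trap_coeff (2 * n j) a * (grid_cos (n j) a (p j) * grid_cos (n j) a i)" for j a i
  define c where "c \<gamma> = complex_of_real (\<Prod>j\<in>{1..d}. trap_coeff (2 * n j) (\<gamma> j) * grid_cos (n j) (\<gamma> j) (p j))" for \<gamma>
  define D where "D x = (\<Prod>j\<in>{1..d}. \<Sum>a\<le>2 * n j. t j a (x j))" for x
  have D_0_iff: "D x = 0 \<longleftrightarrow> x \<noteq> p" if x: "x \<in> index_set d n \<kappa>" for x
  proof -
    have "D x = 0 \<longleftrightarrow> (\<exists>j\<in>{1..d}. x j \<noteq> p j)"
    proof -
      have "(\<Sum>a\<le>2 * n j. t j a (x j)) = 0 \<longleftrightarrow> x j \<noteq> p j" if "j \<in> {1..d}" for j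
        unfolding t_def using that assms(1) index_set_le[OF x that] index_set_le[OF assms(2) that]
        by (intro sum_trap_grid_cos) blast+
      then show ?thesis
        unfolding D_def by (simp add: prod_zero_iff)
    qed
    also have "\<dots> \<longleftrightarrow> x \<noteq> p"
      using PiE_ext[OF index_set_PiE[OF x] index_set_PiE[OF assms(2)]] by blast
    finally show ?thesis .
  qed
  have "(\<Sum>\<gamma>\<in>?R. (\<lambda>x. c \<gamma> * chi d n \<kappa> \<gamma> x)) \<in> cfun.span B"
    using assms(3) by (intro cfun.span_sum cfun.span_scale)
  then have "(\<lambda>x. inverse (of_real (D p)) * (\<Sum>\<gamma>\<in>?R. (\<lambda>x. c \<gamma> * chi d n \<kappa> \<gamma> x)) x) \<in> cfun.span B"
    by (rule cfun.span_scale)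
  also have "(\<lambda>x. inverse (of_real (D p)) * (\<Sum>\<gamma>\<in>?R. (\<lambda>x. c \<gamma> * chi d n \<kappa> \<gamma> x)) x) =
      (\<lambda>x. of_bool (x = p))"
  proof
    fix x
    show "inverse (of_real (D p)) * (\<Sum>\<gamma>\<in>?R. (\<lambda>x. c \<gamma> * chi d n \<kappa> \<gamma> x)) x = of_bool (x = p)"
    proof (cases "x \<in> index_set d n \<kappa>")
      case True
      have "(\<Sum>\<gamma>\<in>?R. (\<lambda>x. c \<gamma> * chi d n \<kappa> \<gamma> x)) x = (\<Sum>\<gamma>\<in>?R. of_real (\<Prod>j\<in>{1..d}. t j (\<gamma> j) (x j)))"
        unfolding sum_fun_apply c_def chi_eq_prod[OF True] t_def of_real_mult[symmetric] prod.distrib[symmetric]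
        by (simp add: mult.assoc)
      also have "\<dots> = of_real (D x)"
        unfolding D_def by (subst prod_sum_PiE) auto
      finally show ?thesis
        using D_0_iff[OF True] D_0_iff[OF assms(2)] by auto
    next
      case False
      then have "x \<noteq> p"
        using assms(2) by auto
      then show ?thesis
        using False by (simp add: sum_fun_apply chi_def)
    qed
  qed
  finally show ?thesis .
qed

lemma span_chi_Gamma:
  assumes "1 \<le> d" "\<forall>j\<in>{1..d}. 1 \<le> n j"
    and "pairwise (\<lambda>i j. coprime (n i) (n j)) {1..d}"
  shows "cfun.span (chi d n \<kappa> ` Gamma_set d n \<kappa>) = fun_space (index_set d n \<kappa>)"
proof
  have "chi d n \<kappa> ` Gamma_set d n \<kappa> \<subseteq> fun_space (index_set d n \<kappa>)"
    by (auto simp: fun_space_def chi_def)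
  then show "cfun.span (chi d n \<kappa> ` Gamma_set d n \<kappa>) \<subseteq> fun_space (index_set d n \<kappa>)"
    by (intro cfun.span_minimal subspace_fun_space)
next
  show "fun_space (index_set d n \<kappa>) \<subseteq> cfun.span (chi d n \<kappa> ` Gamma_set d n \<kappa>)"
  proof
    fix f assume f: "f \<in> fun_space (index_set d n \<kappa>)"
    have "f = (\<Sum>p\<in>index_set d n \<kappa>. (\<lambda>x. f p * of_bool (x = p)))"
    proof
      fix x
      have "(\<Sum>p\<in>index_set d n \<kappa>. f p * of_bool (x = p)) =
          (\<Sum>p\<in>index_set d n \<kappa>. if p = x then f x else 0)"
        by (intro sum.cong) auto
      also have "\<dots> = f x"
        using f finite_index_set[of d n \<kappa>] by (simp add: sum.delta fun_space_def)
      finally show "f x = (\<Sum>p\<in>index_set d n \<kappa>. (\<lambda>x. f p * of_bool (x = p))) x"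
        by (simp add: sum_fun_apply)
    qed
    moreover have "(\<Sum>p\<in>index_set d n \<kappa>. (\<lambda>x. f p * of_bool (x = p))) \<in>
        cfun.span (chi d n \<kappa> ` Gamma_set d n \<kappa>)"
    proof (intro cfun.span_sum cfun.span_scale)
      fix p assume "p \<in> index_set d n \<kappa>"
      then show "(\<lambda>x. of_bool (x = p)) \<in> cfun.span (chi d n \<kappa> ` Gamma_set d n \<kappa>)"
        using point_function_in_span[OF assms(2)] chi_in_span_Gamma[OF assms] by blast
    qed
    ultimately show "f \<in> cfun.span (chi d n \<kappa> ` Gamma_set d n \<kappa>)"
      by simp
  qed
qed

section \<open>Linear independence and the Gram matrix\<close>

lemma finite_Gamma_set: "finite (Gamma_set d n \<kappa>)"
proof -
  have "Gamma_set d n \<kappa> \<subseteq> insert (last_tuple d n) (\<Pi>\<^sub>E j\<in>{1..d}. {..<2 * n j})"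
  proof
    fix \<gamma> assume "\<gamma> \<in> Gamma_set d n \<kappa>"
    then show "\<gamma> \<in> insert (last_tuple d n) (\<Pi>\<^sub>E j\<in>{1..d}. {..<2 * n j})"
      using Gamma_set_cases(1)[of \<gamma> d n \<kappa>] Gamma_set_cases(2)[of \<gamma> d n \<kappa>]
      unfolding insert_iff PiE_iff lessThan_iff by blast
  qed
  then show ?thesis
    by (rule finite_subset) (simp add: finite_PiE)
qed

lemma omega_inner_sum_scale_left:
  "omega_inner d n \<kappa> (\<Sum>v\<in>A. (\<lambda>x. u v * v x)) g = (\<Sum>v\<in>A. u v * omega_inner d n \<kappa> v g)"
  unfolding omega_inner_eq_sum sum_fun_apply sum_distrib_left sum_distrib_right
  by (subst sum.swap) (simp add: mult_ac)

text \<open>Pairing a vanishing combination with a member \<open>g\<close> isolates the coefficient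
  of \<open>g\<close>.\<close>

lemma independent_if_orthogonal:
  assumes "finite S" "\<And>f. f \<in> S \<Longrightarrow> omega_inner d n \<kappa> f f \<noteq> 0"
    and "\<And>f g. f \<in> S \<Longrightarrow> g \<in> S \<Longrightarrow> f \<noteq> g \<Longrightarrow> omega_inner d n \<kappa> f g = 0"
  shows "cfun.independent S"
proof (rule cfun.independent_if_scalars_zero[OF assms(1)])
  fix u g assume eq: "(\<Sum>v\<in>S. (\<lambda>x. u v * v x)) = 0" and g: "g \<in> S"
  have "(\<Sum>v\<in>S. u v * omega_inner d n \<kappa> v g) = (\<Sum>v\<in>S. if v = g then u g * omega_inner d n \<kappa> g g else 0)"
    using assms(3) g by (intro sum.cong) auto
  also have "\<dots> = u g * omega_inner d n \<kappa> g g"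
    using assms(1) g by simp
  finally have "u g * omega_inner d n \<kappa> g g = omega_inner d n \<kappa> 0 g"
    unfolding eq[symmetric] omega_inner_sum_scale_left by simp
  then show "u g = 0"
    using assms(2)[OF g] by (simp add: omega_inner_eq_sum)
qed

text \<open>The complete Gram matrix, from which orthogonality, independence and the norms are read
  off. Hermitian symmetry covers \<open>last_tuple\<close> as the first argument.\<close>

lemma omega_inner_chi_Gamma:
  assumes "1 \<le> d" "\<forall>j\<in>{1..d}. 1 \<le> n j"
    and "pairwise (\<lambda>i j. coprime (n i) (n j)) {1..d}"
    and "\<gamma> \<in> Gamma_set d n \<kappa>" "\<gamma>' \<in> Gamma_set d n \<kappa>"
  shows "omega_inner d n \<kappa> (chi d n \<kappa> \<gamma>) (chi d n \<kappa> \<gamma>') =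
    (if \<gamma> \<noteq> \<gamma>' then 0 else if \<gamma> = last_tuple d n then 1
     else of_real (2 powi (- int (e_num d \<gamma>) + int (f_num d n \<gamma>))))"
proof (cases "\<gamma> = last_tuple d n \<or> \<gamma>' = last_tuple d n")
  case True
  have *: "omega_inner d n \<kappa> (chi d n \<kappa> \<alpha>) (chi d n \<kappa> (last_tuple d n)) = 0"
    if "\<alpha> \<in> Gamma_set d n \<kappa>" "\<alpha> \<noteq> last_tuple d n" for \<alpha>
    using omega_inner_chi_last[OF assms(1,2)] Gamma_set_cases(2)[OF that] by blast
  show ?thesis
    using True *[OF assms(4)] *[OF assms(5)] omega_inner_chi_last_self[OF assms(1,2)]
      omega_inner_commute[of d n \<kappa> "chi d n \<kappa> \<gamma>" "chi d n \<kappa> \<gamma>'"]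
    by (metis complex_cnj_zero)
next
  case False
  then show ?thesis
    using omega_inner_chi_self[OF assms(1-4)] omega_inner_chi_distinct[OF assms(1-4) _ assms(5)] by auto
qed

theorem theorem3p9:
  fixes d :: nat and n :: "nat \<Rightarrow> nat" and \<kappa> :: "nat \<Rightarrow> int"
  assumes "1 \<le> d"
    and "\<forall>j\<in>{1..d}. 1 \<le> n j"
    and "pairwise (\<lambda>i j. coprime (n i) (n j)) {1..d}"
  shows "orthogonal_basis (fun_space (index_set d n \<kappa>)) (omega_inner d n \<kappa>)
           (Gamma_set d n \<kappa>) (chi d n \<kappa>) \<and>
         (\<forall>\<gamma>\<in>Gamma_set d n \<kappa>.
            (omega_norm d n \<kappa> (chi d n \<kappa> \<gamma>))\<^sup>2 =
              (if \<gamma> = last_tuple d n then 1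
               else 2 powi (- int (e_num d \<gamma>) + int (f_num d n \<gamma>))))"
proof -
  note ip = omega_inner_chi_Gamma[OF assms]
  have orth: "omega_inner d n \<kappa> (chi d n \<kappa> \<gamma>) (chi d n \<kappa> \<gamma>') = 0"
    if "\<gamma> \<in> Gamma_set d n \<kappa>" "\<gamma>' \<in> Gamma_set d n \<kappa>" "\<gamma> \<noteq> \<gamma>'" for \<gamma> \<gamma>'
    using ip[OF that(1,2)] that(3) by simp
  have self: "omega_inner d n \<kappa> (chi d n \<kappa> \<gamma>) (chi d n \<kappa> \<gamma>) = of_real
      (if \<gamma> = last_tuple d n then 1 else 2 powi (- int (e_num d \<gamma>) + int (f_num d n \<gamma>)))"
    if "\<gamma> \<in> Gamma_set d n \<kappa>" for \<gamma>
    using ip[OF that that] by simp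
  then have nonzero: "omega_inner d n \<kappa> (chi d n \<kappa> \<gamma>) (chi d n \<kappa> \<gamma>) \<noteq> 0"
    if "\<gamma> \<in> Gamma_set d n \<kappa>" for \<gamma>
    using that by simp
  \<comment> \<open>Equal functions at distinct indices would be orthogonal to themselves, against
    \<open>nonzero\<close>.\<close>
  have "inj_on (chi d n \<kappa>) (Gamma_set d n \<kappa>)"
    using orth nonzero by (metis inj_onI)
  moreover have "cfun.independent (chi d n \<kappa> ` Gamma_set d n \<kappa>)"
    using orth nonzero finite_Gamma_set
    by (intro independent_if_orthogonal[where d = d and n = n and \<kappa> = \<kappa>]) blast+
  ultimately have "orthogonal_basis (fun_space (index_set d n \<kappa>)) (omega_inner d n \<kappa>)
      (Gamma_set d n \<kappa>) (chi d n \<kappa>)"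
    using span_chi_Gamma[OF assms] orth by (simp add: orthogonal_basis_def)
  then show ?thesis
    by (simp add: omega_norm_def self)
qed

end
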